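(* Every recursively enumerable set that is rankable by a partial recursive function is recursive. Equivalently, the class of recursive sets equals the class of recursively enumerable sets that are rankable by a partial recursive function, which also equals the class of recursively enumerable sets that are rankable by a total recursive function.
   Context: All sets are subsets of $\Sigma^\ast$ with $\Sigma=\{0,1\}$, with strings ordered lexicographically in the standard computer-science sense ($\epsilon < 0 < 1 < 00 < \cdots$). A (possibly partial) function $f$ is a ranking function for a set $A$ if $f$ is defined on every element of $A$ and, for each $x\in A$, $f(x)$ is the $i$th string of $\Sigma^\ast$ where $x$ is the $i$th string of $A$ (i.e., $f(x)=\|A^{\le x}\|$, the number of elements of $A$ lexicographically at most $x$); on strings outside $A$ the function may output anything or be undefined. A set is rankable by a partial recursive function (resp. total recursive function) if some partial recursive (resp. total recursive) function from $\Sigma^\ast$ to $\Sigma^\ast$ is a ranking function for it. *)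

theory Defs
  imports Main "HOL-Library.List_Lenlexorder"
begin

(* The theory List_Lenlexorder orders lists first by length and then lexicographically, so for
   0 = False and 1 = True the order on bool list is  [] < 0 < 1 < 00 < 01 < ...  *)

type_synonym str = "bool list"

(* The Kleene partial recursive functions of n arguments on the natural numbers. In
   "mu_recursive n f" the function f takes its arguments as a list, and only its values on lists
   of length n are meaningful; None stands for "undefined". *)

definition comp_fun :: "(nat list \<Rightarrow> nat option) \<Rightarrow> (nat list \<Rightarrow> nat option) list \<Rightarrow> nat list \<Rightarrow> nat option"
  where "comp_fun f gs xs = Option.bind (those (map (\<lambda>g. g xs) gs)) f"

definition prim_rec :: "(nat list \<Rightarrow> nat option) \<Rightarrow> (nat list \<Rightarrow> nat option) \<Rightarrow> nat list \<Rightarrow> nat option"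
  where "prim_rec f g xs =
    rec_nat (f (tl xs)) (\<lambda>k r. Option.bind r (\<lambda>v. g (k # v # tl xs))) (hd xs)"

(* Unbounded search: all values strictly before the first zero must be defined. *)
definition minimize :: "(nat list \<Rightarrow> nat option) \<Rightarrow> nat list \<Rightarrow> nat option"
  where "minimize f xs =
    (if \<exists>k. f (k # xs) = Some 0 \<and> (\<forall>j<k. \<exists>v>0. f (j # xs) = Some v)
     then Some (LEAST k. f (k # xs) = Some 0) else None)"

inductive mu_recursive :: "nat \<Rightarrow> (nat list \<Rightarrow> nat option) \<Rightarrow> bool" where
  zero: "mu_recursive n (\<lambda>xs. Some 0)"
| succ: "mu_recursive 1 (\<lambda>xs. Some (Suc (hd xs)))"
| proj: "i < n \<Longrightarrow> mu_recursive n (\<lambda>xs. Some (xs ! i))"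
| comp: "mu_recursive (length gs) f \<Longrightarrow> \<forall>g\<in>set gs. mu_recursive n g \<Longrightarrow>
    mu_recursive n (comp_fun f gs)"
| prim: "mu_recursive n f \<Longrightarrow> mu_recursive (n + 2) g \<Longrightarrow> mu_recursive (n + 1) (prim_rec f g)"
| mini: "mu_recursive (n + 1) f \<Longrightarrow> mu_recursive n (minimize f)"

(* The order isomorphism between strings and natural numbers, [] being number 0. *)
definition str_num :: "str \<Rightarrow> nat"
  where "str_num x = card {y. y < x}"

(* Since str_num is a bijection, partial functions on strings and unary partial functions on
   natural numbers correspond to each other. *)
definition partial_recursive :: "(str \<Rightarrow> str option) \<Rightarrow> bool"
  where "partial_recursive f \<longleftrightarrow>
    (\<exists>g. mu_recursive 1 g \<and> (\<forall>x. g [str_num x] = map_option str_num (f x)))"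

definition total_recursive :: "(str \<Rightarrow> str) \<Rightarrow> bool"
  where "total_recursive f \<longleftrightarrow> partial_recursive (\<lambda>x. Some (f x))"

(* The characteristic function takes the strings 1 and 0 as truth values. *)
definition recursive_set :: "str set \<Rightarrow> bool"
  where "recursive_set A \<longleftrightarrow> total_recursive (\<lambda>x. if x \<in> A then [True] else [False])"

definition re_set :: "str set \<Rightarrow> bool"
  where "re_set A \<longleftrightarrow> A = {} \<or> (\<exists>g. total_recursive g \<and> A = range g)"

(* An element x of A is the i-th string of A, counting from 1, iff position A x = i. *)
definition position :: "str set \<Rightarrow> str \<Rightarrow> nat"
  where "position A x = card {y \<in> A. y \<le> x}"

definition ranking_function :: "(str \<Rightarrow> str option) \<Rightarrow> str set \<Rightarrow> bool"
  where "ranking_function f A \<longleftrightarrow>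
    (\<forall>x\<in>A. \<exists>s. f x = Some s \<and> position UNIV s = position A x)"

definition partial_rankable :: "str set \<Rightarrow> bool"
  where "partial_rankable A \<longleftrightarrow> (\<exists>f. partial_recursive f \<and> ranking_function f A)"

definition total_rankable :: "str set \<Rightarrow> bool"
  where "total_rankable A \<longleftrightarrow>
    (\<exists>f. total_recursive f \<and> ranking_function (\<lambda>x. Some (f x)) A)"

lemma length_le_of_less_str: "y < x \<Longrightarrow> length y \<le> length x" for x y :: str
  by (auto simp: list_less_def lenlex_conv)

lemma finite_less_str: "finite {y. y < (x :: str)}"
proof (rule finite_subset)
  show "{y. y < x} \<subseteq> {y. set y \<subseteq> UNIV \<and> length y \<le> length x}"
    by (auto dest: length_le_of_less_str)
  show "finite {y :: str. set y \<subseteq> UNIV \<and> length y \<le> length x}"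
    by (rule finite_lists_length_le) simp
qed

lemma finite_le_str: "finite {y. y \<le> (x :: str)}"
proof -
  have "{y. y \<le> x} = insert x {y. y < x}" by auto
  then show ?thesis by (simp add: finite_less_str)
qed

lemma strict_mono_str_num: "strict_mono str_num"
proof (rule strict_monoI)
  fix x y :: str
  assume "x < y"
  then have "{z. z < x} \<subset> {z. z < y}" by auto
  then show "str_num x < str_num y"
    unfolding str_num_def by (intro psubset_card_mono finite_less_str)
qed

lemma bij_str_num: "bij str_num"
proof -
  have inj: "inj str_num" by (rule strict_mono_imp_inj_on[OF strict_mono_str_num])
  have below: "{..str_num x} \<subseteq> range str_num" for x
  proof -
    have "str_num ` {y. y \<le> x} \<subseteq> {..str_num x}"
      using strict_mono_less_eq[OF strict_mono_str_num] by auto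
    moreover have "card (str_num ` {y. y \<le> x}) = card {..str_num x}"
    proof -
      have "{y. y \<le> x} = insert x {y. y < x}" by auto
      then have "card {y. y \<le> x} = Suc (str_num x)"
        by (simp add: str_num_def finite_less_str)
      then show ?thesis using inj by (simp add: card_image inj_on_subset)
    qed
    ultimately have "str_num ` {y. y \<le> x} = {..str_num x}"
      by (intro card_subset_eq) auto
    then show ?thesis by blast
  qed
  have "infinite (range str_num)"
    using inj by (simp add: finite_image_iff infinite_UNIV_listI)
  then have "\<exists>x. n \<le> str_num x" for n
    unfolding finite_nat_set_iff_bounded by (metis imageE nle_le not_less)
  then have "surj str_num" using below by blast
  with inj show ?thesis by (rule bijI)
qed

end

theory Submission
  imports Defs "HOL-Library.Infinite_Set"
begin

text \<open>For an infinite recursively enumerable set of numbers with enumeration \<open>G\<close> and ranking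
  function \<open>F\<close>, the \<open>r\<close>-th element is \<open>G i\<close> for the first \<open>i\<close> with \<open>F (G i) = r\<close>. This evaluates
  \<open>F\<close> only on elements of the set, so the increasing enumeration is total recursive, and \<open>n\<close>
  belongs to the set iff it is the first value \<open>\<ge> n\<close> of that enumeration. Finite sets are
  treated separately, so the proof is not uniform in the set. Conversely, the rank of an
  element of a recursive set is computed by primitive recursion from the characteristic function.\<close>

section \<open>Total recursive functions on natural numbers\<close>

text \<open>Plain \<open>nat\<close> values spare the closure proofs the \<open>option\<close> type.
  Only lists of length \<open>n\<close> count, as for \<open>mu_recursive\<close>.\<close>

definition total_mu :: "nat \<Rightarrow> (nat list \<Rightarrow> nat) \<Rightarrow> bool"
  where "total_mu n f \<longleftrightarrow>
    (\<exists>g. mu_recursive n g \<and> (\<forall>xs. length xs = n \<longrightarrow> g xs = Some (f xs)))"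

lemma total_mu_cong:
  assumes "total_mu n f" "\<And>xs. length xs = n \<Longrightarrow> f xs = g xs"
  shows "total_mu n g"
  using assms by (auto simp: total_mu_def)

lemma those_map_Some: "those (map (\<lambda>x. Some (f x)) xs) = Some (map f xs)"
  by (induction xs) auto

text \<open>The outer \<open>f\<close> has to be defined only on the tuples that the inner functions
  produce. This is how a partial ranking function yields a total function.\<close>

lemma total_mu_comp_partial:
  assumes f: "mu_recursive (length gs) f" and gs: "\<And>g. g \<in> set gs \<Longrightarrow> total_mu n g"
    and h: "\<And>xs. length xs = n \<Longrightarrow> f (map (\<lambda>g. g xs) gs) = Some (h xs)"
  shows "total_mu n h"
proof -
  obtain G where G: "\<And>g. g \<in> set gs \<Longrightarrow> mu_recursive n (G g)"
    "\<And>g xs. g \<in> set gs \<Longrightarrow> length xs = n \<Longrightarrow> G g xs = Some (g xs)"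
    using gs unfolding total_mu_def by metis
  have "mu_recursive n (comp_fun f (map G gs))"
    using f G by (intro mu_recursive.comp) auto
  moreover have "comp_fun f (map G gs) xs = Some (h xs)" if xs: "length xs = n" for xs
  proof -
    have "map (\<lambda>g. g xs) (map G gs) = map (\<lambda>g. Some (g xs)) gs"
      using G(2) xs by auto
    then show ?thesis using h[OF xs] by (simp only: comp_fun_def those_map_Some) simp
  qed
  ultimately show ?thesis by (auto simp: total_mu_def)
qed

lemma total_mu_comp:
  assumes f: "total_mu (length gs) f" and gs: "\<And>g. g \<in> set gs \<Longrightarrow> total_mu n g"
  shows "total_mu n (\<lambda>xs. f (map (\<lambda>g. g xs) gs))"
proof -
  obtain f' where f': "mu_recursive (length gs) f'"
    "\<And>xs. length xs = length gs \<Longrightarrow> f' xs = Some (f xs)"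
    using f by (auto simp: total_mu_def)
  show ?thesis by (rule total_mu_comp_partial[OF f'(1) gs]) (simp_all add: f'(2))
qed

lemma total_mu_nth: "i < n \<Longrightarrow> total_mu n (\<lambda>xs. xs ! i)"
  unfolding total_mu_def using mu_recursive.proj by blast

lemma total_mu_hd: "total_mu (Suc n) hd"
  by (rule total_mu_cong[OF total_mu_nth[of 0]]) (auto simp: length_Suc_conv)

lemma total_mu_hd_comp:
  assumes "total_mu 1 (\<lambda>xs. f (hd xs))" "total_mu n g"
  shows "total_mu n (\<lambda>xs. f (g xs))"
  using total_mu_comp[of "[g]" "\<lambda>xs. f (hd xs)" n] assms by simp

lemma total_mu_Suc:
  assumes "total_mu n f"
  shows "total_mu n (\<lambda>xs. Suc (f xs))"
proof (rule total_mu_hd_comp[OF _ assms])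
  show "total_mu 1 (\<lambda>xs. Suc (hd xs))"
    unfolding total_mu_def using mu_recursive.succ by blast
qed

lemma total_mu_const: "total_mu n (\<lambda>xs. c)"
proof (induction c)
  case 0
  then show ?case unfolding total_mu_def using mu_recursive.zero by blast
next
  case (Suc c)
  then show ?case by (rule total_mu_Suc)
qed

lemma total_mu_tl:
  assumes "total_mu n f"
  shows "total_mu (Suc n) (\<lambda>xs. f (tl xs))"
proof -
  let ?gs = "map (\<lambda>i xs :: nat list. xs ! Suc i) [0..<n]"
  have comp: "total_mu (Suc n) (\<lambda>xs. f (map (\<lambda>g. g xs) ?gs))"
    by (rule total_mu_comp) (use assms in \<open>auto intro: total_mu_nth\<close>)
  have "map (\<lambda>g. g xs) ?gs = tl xs" if "length xs = Suc n" for xs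
    using that by (intro nth_equalityI) (auto simp: nth_tl)
  then show ?thesis by (intro total_mu_cong[OF comp]) (simp only:)
qed

text \<open>\<open>prim_rec\<close> recurses on its first argument. Composing it with
  \<open>c\<close> and all \<open>n\<close> projections lets the recursion run to a computed bound
  with \<open>xs\<close> as parameters.\<close>

lemma total_mu_rec_nat:
  assumes c: "total_mu n c" and a: "total_mu n a" and g: "total_mu (Suc (Suc n)) g"
  shows "total_mu n (\<lambda>xs. rec_nat (a xs) (\<lambda>k v. g (k # v # xs)) (c xs))"
proof -
  obtain a' where a': "mu_recursive n a'" "\<And>xs. length xs = n \<Longrightarrow> a' xs = Some (a xs)"
    using a by (auto simp: total_mu_def)
  obtain g' where g': "mu_recursive (n + 2) g'"
    "\<And>xs. length xs = Suc (Suc n) \<Longrightarrow> g' xs = Some (g xs)"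
    using g by (auto simp: total_mu_def)
  let ?gs = "c # map (\<lambda>i xs. xs ! i) [0..<n]"
  show ?thesis
  proof (rule total_mu_comp_partial)
    show "mu_recursive (length ?gs) (prim_rec a' g')"
      using mu_recursive.prim[OF a'(1) g'(1)] by simp
    show "total_mu n h" if "h \<in> set ?gs" for h
      using that c by (auto intro: total_mu_nth)
    fix xs :: "nat list"
    assume xs: "length xs = n"
    then have gs: "map (\<lambda>g. g xs) ?gs = c xs # xs"
      using map_nth[of xs] by (simp add: comp_def)
    have "prim_rec a' g' (m # xs) = Some (rec_nat (a xs) (\<lambda>k v. g (k # v # xs)) m)" for m
      using xs by (induction m) (simp_all add: prim_rec_def a'(2) g'(2))
    then show "prim_rec a' g' (map (\<lambda>g. g xs) ?gs)
        = Some (rec_nat (a xs) (\<lambda>k v. g (k # v # xs)) (c xs))"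
      by (simp only: gs)
  qed
qed

text \<open>All values of \<open>f\<close> before the first zero are defined, so
  \<open>minimize\<close> succeeds as soon as some zero exists.\<close>

lemma total_mu_Least:
  assumes f: "total_mu (Suc n) f" and ex: "\<And>xs. length xs = n \<Longrightarrow> \<exists>k. f (k # xs) = 0"
  shows "total_mu n (\<lambda>xs. LEAST k. f (k # xs) = 0)"
proof -
  obtain f' where f': "mu_recursive (n + 1) f'"
    "\<And>xs. length xs = Suc n \<Longrightarrow> f' xs = Some (f xs)"
    using f by (auto simp: total_mu_def)
  have "minimize f' xs = Some (LEAST k. f (k # xs) = 0)" if xs: "length xs = n" for xs
  proof -
    have "\<exists>k. f (k # xs) = 0 \<and> (\<forall>j<k. f (j # xs) > 0)"
      using ex[OF xs] exists_least_iff[of "\<lambda>k. f (k # xs) = 0"] by simp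
    then show ?thesis using xs by (simp add: minimize_def f'(2))
  qed
  then show ?thesis
    unfolding total_mu_def using mu_recursive.mini[OF f'(1)] by blast
qed

section \<open>Arithmetic and case distinctions\<close>

lemma total_mu_add:
  assumes "total_mu n f" "total_mu n g"
  shows "total_mu n (\<lambda>xs. f xs + g xs)"
proof -
  have "total_mu n (\<lambda>xs. rec_nat (f xs) (\<lambda>k v. Suc ((k # v # xs) ! 1)) (g xs))"
    by (intro total_mu_rec_nat assms total_mu_Suc total_mu_nth) simp
  moreover have "rec_nat a (\<lambda>k v. Suc ((k # v # xs) ! 1)) b = a + b" for a b and xs :: "nat list"
    by (induction b) auto
  ultimately show ?thesis by simp
qed

lemma total_mu_diff:
  assumes "total_mu n f" "total_mu n g"
  shows "total_mu n (\<lambda>xs. f xs - g xs)"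
proof -
  have pred: "total_mu n (\<lambda>xs. h xs - 1)" if "total_mu n h" for n h
  proof -
    have "total_mu n (\<lambda>xs. rec_nat 0 (\<lambda>k v. (k # v # xs) ! 0) (h xs))"
      by (intro total_mu_rec_nat that total_mu_const total_mu_nth) simp
    moreover have "rec_nat 0 (\<lambda>k v. (k # v # xs) ! 0) b = b - 1" for b and xs :: "nat list"
      by (cases b) auto
    ultimately show ?thesis by simp
  qed
  have "total_mu n (\<lambda>xs. rec_nat (f xs) (\<lambda>k v. (k # v # xs) ! 1 - 1) (g xs))"
    by (intro total_mu_rec_nat[where g = "\<lambda>xs. xs ! 1 - 1"] assms pred total_mu_nth) simp
  moreover have "rec_nat a (\<lambda>k v. (k # v # xs) ! 1 - 1) b = a - b" for a b and xs :: "nat list"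
    by (induction b) auto
  ultimately show ?thesis by simp
qed

lemma total_mu_if_zero:
  assumes "total_mu n c" "total_mu n f" "total_mu n g"
  shows "total_mu n (\<lambda>xs. if c xs = 0 then f xs else g xs)"
proof -
  \<comment> \<open>A recursion that ignores the previous value is a case distinction; the two
    \<open>tl\<close> drop the counter and that value before \<open>g\<close> is applied.\<close>
  have "total_mu n (\<lambda>xs. rec_nat (f xs) (\<lambda>k v. g (tl (tl (k # v # xs)))) (c xs))"
    by (rule total_mu_rec_nat[OF assms(1,2) total_mu_tl[OF total_mu_tl[OF assms(3)]]])
  moreover have "rec_nat a (\<lambda>k v. b) m = (if m = 0 then a else b)" for a b m :: nat
    by (cases m) auto
  ultimately show ?thesis by simp
qed

lemma total_mu_if_eq:
  assumes "total_mu n c" "total_mu n d" "total_mu n f" "total_mu n g"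
  shows "total_mu n (\<lambda>xs. if c xs = d xs then f xs else g xs)"
proof -
  \<comment> \<open>Subtraction is truncated, so the sum of both differences vanishes only at
    equality.\<close>
  have "total_mu n (\<lambda>xs. if (c xs - d xs) + (d xs - c xs) = 0 then f xs else g xs)"
    by (intro total_mu_if_zero total_mu_add total_mu_diff assms)
  moreover have "(a - b) + (b - a) = 0 \<longleftrightarrow> a = b" for a b :: nat by auto
  ultimately show ?thesis by simp
qed

section \<open>Decidable sets of natural numbers\<close>

text \<open>The truth values 1 and 2 are the numbers of the strings \<open>0\<close> and \<open>1\<close>.\<close>

definition decidable_nat :: "nat set \<Rightarrow> bool"
  where "decidable_nat B \<longleftrightarrow> total_mu 1 (\<lambda>xs. if hd xs \<in> B then 2 else 1)"

lemma decidable_nat_finite: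
  assumes "finite B"
  shows "decidable_nat B"
  using assms
proof (induction B)
  case empty
  then show ?case using total_mu_const by (simp add: decidable_nat_def)
next
  case (insert b B)
  have "total_mu 1 (\<lambda>xs. if hd xs = b then 2 else if hd xs \<in> B then 2 else 1)"
    using insert.IH total_mu_hd[of 0]
    by (intro total_mu_if_eq total_mu_const) (simp_all add: decidable_nat_def)
  moreover have "(if m = b then 2 else if m \<in> B then 2 else 1)
      = (if m \<in> insert b B then 2 else (1 :: nat))" for m
    by simp
  ultimately show ?case by (simp only: decidable_nat_def)
qed

text \<open>\<open>enumerate\<close> counts from 0 and is strictly increasing, so exactly the
  indices below \<open>r\<close> give smaller elements. Rank and index thus agree.\<close>

lemma card_less_enumerate:
  fixes B :: "nat set"
  assumes "infinite B"
  shows "card {z \<in> B. z < enumerate B r} = r"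
proof -
  have "z \<in> enumerate B ` {..<r}" if "z \<in> B" "z < enumerate B r" for z
    using that enumerate_Ex[OF assms that(1)] assms by (auto simp: enumerate_mono_iff)
  then have "{z \<in> B. z < enumerate B r} = enumerate B ` {..<r}"
    using assms by (auto simp: enumerate_in_set enumerate_mono_iff)
  then show ?thesis
    using strict_mono_enumerate[OF assms]
    by (simp add: card_image strict_mono_imp_inj_on inj_on_subset)
qed

lemma decidable_nat_infinite:
  assumes inf: "infinite B" and G: "total_mu 1 (\<lambda>xs. G (hd xs))" and B: "B = range G"
    and F: "mu_recursive 1 F" "\<And>b. b \<in> B \<Longrightarrow> F [b] = Some (card {z \<in> B. z < b})"
  shows "decidable_nat B"
proof -
  define rank where "rank i = card {z \<in> B. z < G i}" for i
  have G_rank: "G i = enumerate B (rank i)" for i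
  proof -
    obtain r where "enumerate B r = G i"
      using enumerate_Ex[OF inf, of "G i"] B by blast
    then show ?thesis
      using card_less_enumerate[OF inf, of r] by (simp add: rank_def)
  qed
  have ex_rank: "\<exists>i. rank i = r" for r
  proof -
    obtain i where "enumerate B r = G i"
      using enumerate_in_set[OF inf, of r] B by blast
    then have "rank i = r"
      using card_less_enumerate[OF inf, of r] by (simp add: rank_def)
    then show ?thesis ..
  qed
  have F_G: "F [G i] = Some (rank i)" for i
    unfolding rank_def by (rule F(2)) (simp add: B)
  \<comment> \<open>\<open>F\<close> is applied only to values of \<open>G\<close>; these lie in
    \<open>B\<close>, where \<open>F\<close> is defined.\<close>
  have rank: "total_mu 1 (\<lambda>xs. rank (hd xs))"
    by (rule total_mu_comp_partial[of "[\<lambda>xs. G (hd xs)]" F])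
      (use F(1) G in \<open>simp_all add: F_G\<close>)
  \<comment> \<open>The distance between \<open>rank i\<close> and \<open>r\<close> is zero iff they
    agree. \<open>G\<close> may repeat values, so the first such \<open>i\<close> is taken.\<close>
  define first where
    "first r = (LEAST i. (rank i - r) + (r - rank i) = 0)" for r
  have first: "total_mu 1 (\<lambda>xs. first (hd xs))"
  proof -
    let ?d = "\<lambda>xs. (rank (hd xs) - xs ! 1) + (xs ! 1 - rank (hd xs))"
    have "total_mu (Suc 1) ?d"
      by (intro total_mu_add total_mu_diff total_mu_hd_comp[OF rank] total_mu_hd total_mu_nth)
        simp_all
    moreover have "\<exists>k. ?d (k # xs) = 0" for xs
    proof -
      obtain i where "rank i = xs ! 0" using ex_rank by blast
      then have "?d (i # xs) = 0" by simp
      then show ?thesis ..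
    qed
    ultimately have "total_mu 1 (\<lambda>xs. LEAST k. ?d (k # xs) = 0)"
      by (intro total_mu_Least)
    then show ?thesis
      by (rule total_mu_cong) (auto simp: first_def length_Suc_conv)
  qed
  have "rank (first r) = r" for r
    using LeastI_ex[of "\<lambda>i. (rank i - r) + (r - rank i) = 0"] ex_rank[of r]
    unfolding first_def by fastforce
  then have G_first: "G (first r) = enumerate B r" for r
    by (simp add: G_rank)
  have enum: "total_mu n (\<lambda>xs. enumerate B (h xs))" if "total_mu n h" for n h
    using total_mu_hd_comp[OF G total_mu_hd_comp[OF first that]] by (simp add: G_first)
  \<comment> \<open>The truncated difference is zero iff \<open>n \<le> enumerate B r\<close>, so
    this is the least element of \<open>B\<close> that is at least \<open>n\<close>.\<close>
  define next_elem where "next_elem n = enumerate B (LEAST r. n - enumerate B r = 0)" for n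
  have next_elem: "total_mu 1 (\<lambda>xs. next_elem (hd xs))"
  proof -
    let ?d = "\<lambda>xs. xs ! 1 - enumerate B (hd xs)"
    have "total_mu (Suc 1) ?d"
      by (intro total_mu_diff enum total_mu_hd total_mu_nth) simp
    \<comment> \<open>The search ends because \<open>k \<le> enumerate B k\<close>: taking
      \<open>k\<close> to be the argument suffices.\<close>
    moreover have "\<exists>k. ?d (k # xs) = 0" for xs
      using le_enumerate[OF inf] by auto
    ultimately have "total_mu 1 (\<lambda>xs. enumerate B (LEAST k. ?d (k # xs) = 0))"
      by (intro enum total_mu_Least)
    then show ?thesis
      by (rule total_mu_cong) (auto simp: next_elem_def length_Suc_conv)
  qed
  have "next_elem n = n \<longleftrightarrow> n \<in> B" for n
  proof
    assume "next_elem n = n"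
    then show "n \<in> B" using enumerate_in_set[OF inf] by (metis next_elem_def)
  next
    assume "n \<in> B"
    then obtain r where r: "n = enumerate B r" using enumerate_Ex[OF inf] by metis
    have "(LEAST s. n - enumerate B s = 0) = r"
      by (rule Least_equality) (auto simp: r inf)
    then show "next_elem n = n" by (simp add: next_elem_def r)
  qed
  moreover have "total_mu 1 (\<lambda>xs. if next_elem (hd xs) = hd xs then 2 else 1)"
    using total_mu_hd[of 0] by (intro total_mu_if_eq next_elem total_mu_const) simp_all
  ultimately show ?thesis by (simp add: decidable_nat_def)
qed

lemma total_mu_card_less:
  assumes "decidable_nat B"
  shows "total_mu 1 (\<lambda>xs. card {z \<in> B. z < hd xs})"
proof -
  let ?chi = "\<lambda>m. if m \<in> B then 2 else 1 :: nat"
  have chi: "total_mu 1 (\<lambda>xs. ?chi (hd xs))"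
    using assms by (simp add: decidable_nat_def)
  \<comment> \<open>Subtracting 1 turns the truth values 1 and 2 into the increments 0 and 1;
    \<open>hd xs\<close> is the counter and \<open>xs ! 1\<close> the count so far.\<close>
  let ?g = "\<lambda>xs. xs ! 1 + (?chi (hd xs) - 1)"
  have "total_mu 1 (\<lambda>xs. rec_nat 0 (\<lambda>k v. ?g (k # v # xs)) (hd xs))"
    using total_mu_hd[of 0]
    by (intro total_mu_rec_nat[where g = ?g] total_mu_const total_mu_add total_mu_diff
        total_mu_nth total_mu_hd_comp[OF chi] total_mu_hd) simp_all
  moreover have "rec_nat 0 (\<lambda>k v. ?g (k # v # xs)) m = card {z \<in> B. z < m}" for xs m
  proof (induction m)
    case (Suc m)
    have "{z \<in> B. z < Suc m} = {z \<in> B. z < m} \<union> (if m \<in> B then {m} else {})"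
      by (auto simp: less_Suc_eq)
    then show ?case using Suc by simp
  qed simp
  ultimately show ?thesis by simp
qed

section \<open>Transfer to strings\<close>

lemma str_num_inv: "str_num (inv str_num n) = n"
  using bij_str_num by (simp add: bij_is_surj surj_f_inv_f)

lemma inv_str_num: "inv str_num (str_num x) = x"
  using bij_str_num by (simp add: bij_is_inj)

lemma str_num_in_image: "str_num x \<in> str_num ` A \<longleftrightarrow> x \<in> A"
  using bij_str_num by (auto simp: bij_def inj_def)

text \<open>Every number is the number of some string, so prescribing \<open>g\<close> at all
  \<open>[str_num x]\<close> fixes it on all one-element lists.\<close>

lemma total_recursive_iff:
  "total_recursive f \<longleftrightarrow> total_mu 1 (\<lambda>xs. str_num (f (inv str_num (hd xs))))"
proof
  assume "total_recursive f"
  then obtain g where g: "mu_recursive 1 g" "\<And>x. g [str_num x] = Some (str_num (f x))"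
    by (auto simp: total_recursive_def partial_recursive_def)
  have "g [n] = Some (str_num (f (inv str_num n)))" for n
    using g(2)[of "inv str_num n"] by (simp add: str_num_inv)
  with g(1) show "total_mu 1 (\<lambda>xs. str_num (f (inv str_num (hd xs))))"
    unfolding total_mu_def by (auto simp: length_Suc_conv)
next
  assume "total_mu 1 (\<lambda>xs. str_num (f (inv str_num (hd xs))))"
  then show "total_recursive f"
    unfolding total_mu_def total_recursive_def partial_recursive_def
    by (force simp: inv_str_num)
qed

lemma str_num_False: "str_num [False] = 1"
proof -
  have "{y. y < [False]} = {[]}"
    by (auto simp: list_less_def lenlex_conv length_Suc_conv lex_conv Cons_eq_append_conv)
  then show ?thesis by (simp add: str_num_def)
qed

lemma str_num_True: "str_num [True] = 2"
proof -
  have "{y. y < [True]} = {[], [False]}"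
    by (auto simp: list_less_def lenlex_conv length_Suc_conv lex_conv Cons_eq_append_conv)
  then show ?thesis by (simp add: str_num_def)
qed

lemma recursive_set_iff: "recursive_set A \<longleftrightarrow> decidable_nat (str_num ` A)"
proof -
  have "inv str_num n \<in> A \<longleftrightarrow> n \<in> str_num ` A" for n
    using str_num_in_image[of "inv str_num n" A] by (simp add: str_num_inv)
  then show ?thesis
    unfolding recursive_set_def total_recursive_iff decidable_nat_def
    by (simp add: if_distrib str_num_False str_num_True cong: if_cong)
qed

text \<open>Positions count from 1, whereas \<open>str_num\<close> counts from 0.\<close>

lemma position_UNIV: "position UNIV x = Suc (str_num x)"
proof -
  have "{y. y \<le> x} = insert x {y. y < x}" by auto
  then show ?thesis by (simp add: position_def str_num_def finite_less_str)
qed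

text \<open>The extra 1 counts \<open>x\<close> itself; \<open>str_num\<close> preserves the strict
  order, so the elements below \<open>x\<close> can be counted as numbers.\<close>

lemma position_in:
  assumes "x \<in> A"
  shows "position A x = Suc (card {z \<in> str_num ` A. z < str_num x})"
proof -
  have "{y \<in> A. y \<le> x} = insert x {y \<in> A. y < x}" using assms by auto
  moreover have "finite {y \<in> A. y < x}"
    using finite_less_str[of x] by (rule rev_finite_subset) auto
  moreover have "{z \<in> str_num ` A. z < str_num x} = str_num ` {y \<in> A. y < x}"
    using strict_mono_less[OF strict_mono_str_num] by auto
  moreover have "inj_on str_num {y \<in> A. y < x}"
    using bij_str_num by (auto simp: bij_def intro: inj_on_subset)
  ultimately show ?thesis by (simp add: position_def card_image)
qed

text \<open>Both positions are one more than a count of strictly smaller elements, so the offsets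
  cancel and ranks start at 0.\<close>

lemma ranking_function_iff:
  "ranking_function f A \<longleftrightarrow>
    (\<forall>x\<in>A. map_option str_num (f x) = Some (card {z \<in> str_num ` A. z < str_num x}))"
  by (auto simp: ranking_function_def position_UNIV position_in)

section \<open>Implications between the three classes\<close>

lemma recursive_set_if_re_partial_rankable:
  assumes "re_set A" "partial_rankable A"
  shows "recursive_set A"
proof (cases "finite A")
  case True
  then show ?thesis by (simp add: recursive_set_iff decidable_nat_finite)
next
  case False
  obtain f F where F: "ranking_function f A" "mu_recursive 1 F"
    "\<And>x. F [str_num x] = map_option str_num (f x)"
    using assms(2) by (auto simp: partial_rankable_def partial_recursive_def)
  obtain g where g: "total_recursive g" "A = range g"
    using assms(1) False by (auto simp: re_set_def)
  let ?G = "\<lambda>n. str_num (g (inv str_num n))"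
  have "decidable_nat (str_num ` A)"
  proof (rule decidable_nat_infinite[where F = F])
    show "infinite (str_num ` A)"
      using False bij_str_num by (metis bij_is_inj finite_image_iff inj_on_subset subset_UNIV)
    show "total_mu 1 (\<lambda>xs. ?G (hd xs))"
      using g(1) by (simp add: total_recursive_iff)
    have "str_num (g x) = ?G (str_num x)" for x by (simp add: inv_str_num)
    then show "str_num ` A = range ?G" using g(2) by blast
    show "F [b] = Some (card {z \<in> str_num ` A. z < b})" if "b \<in> str_num ` A" for b
      using that F(1,3) by (auto simp: ranking_function_iff)
  qed (rule F(2))
  then show ?thesis by (simp add: recursive_set_iff)
qed

lemma re_set_if_recursive:
  assumes "recursive_set A"
  shows "re_set A"
proof (cases "A = {}")
  case False
  then obtain a where a: "a \<in> A" by blast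
  \<comment> \<open>\<open>?g\<close> enumerates \<open>A\<close> by fixing its elements and sending
    every other string to \<open>a\<close>.\<close>
  let ?B = "str_num ` A" and ?g = "\<lambda>x. if x \<in> A then x else a"
  have chi: "total_mu 1 (\<lambda>xs. if hd xs \<in> ?B then 2 else 1)"
    using assms by (simp add: recursive_set_iff decidable_nat_def)
  have "total_mu 1 (\<lambda>xs. if (if hd xs \<in> ?B then 2 else 1) = (2 :: nat) then hd xs else str_num a)"
    using total_mu_hd[of 0] by (intro total_mu_if_eq chi total_mu_const) simp_all
  moreover have "(if (if n \<in> ?B then 2 else 1) = (2 :: nat) then n else str_num a)
      = str_num (?g (inv str_num n))" for n
    using str_num_in_image[of "inv str_num n" A] by (simp add: str_num_inv)
  ultimately have "total_recursive ?g" by (simp only: total_recursive_iff)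
  moreover have "A = range ?g" using a by auto
  ultimately show ?thesis unfolding re_set_def by blast
qed (simp add: re_set_def)

lemma total_rankable_if_recursive:
  assumes "recursive_set A"
  shows "total_rankable A"
proof -
  \<comment> \<open>The count of smaller elements of \<open>A\<close> makes sense for every string,
    so the function is total.\<close>
  let ?f = "\<lambda>x. inv str_num (card {z \<in> str_num ` A. z < str_num x})"
  have "total_recursive ?f"
    using assms total_mu_card_less
    by (simp add: total_recursive_iff recursive_set_iff str_num_inv)
  moreover have "ranking_function (\<lambda>x. Some (?f x)) A"
    by (simp add: ranking_function_iff str_num_inv)
  ultimately show ?thesis unfolding total_rankable_def by blast
qed

lemma partial_rankable_if_total_rankable: "total_rankable A \<Longrightarrow> partial_rankable A"
  by (auto simp: total_rankable_def partial_rankable_def total_recursive_def)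

theorem theorem9:
  shows "(\<forall>A. re_set A \<and> partial_rankable A \<longrightarrow> recursive_set A) \<and>
    {A. recursive_set A} = {A. re_set A \<and> partial_rankable A} \<and>
    {A. re_set A \<and> partial_rankable A} = {A. re_set A \<and> total_rankable A}"
  \<comment> \<open>\<open>re_set\<close> with \<open>partial_rankable\<close> gives
    \<open>recursive_set\<close>, which gives \<open>re_set\<close> with
    \<open>total_rankable\<close>, and this leads back to the start.\<close>
  using recursive_set_if_re_partial_rankable re_set_if_recursive total_rankable_if_recursive
    partial_rankable_if_total_rankable
  by blast

end
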